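(* Let $M$ be a monoid, let $A$ be a finitely presented $M$-act, and let $B$ be a finitely generated subact of $A$. Then the Rees quotient $A/B$ is finitely presented if and only if the trivial (one-element) $M$-act is finitely presented (and the latter condition holds for all finitely generated monoids $M$).
   Context: Let $M$ be a monoid with identity $1$. A (right) $M$-act is a non-empty set $A$ with a map $A\times M\to A$, $(a,m)\mapsto am$, with $a(mn)=(am)n$ and $a1=a$. A subact of $A$ is a non-empty subset $B$ with $bm\in B$ for all $b\in B$, $m\in M$. A subset $U$ generates $A$ if every $a\in A$ is $um$ for some $u\in U$, $m\in M$; $A$ is finitely generated if it has a finite generating set. A congruence on $A$ is an equivalence relation $\rho$ with $(a,b)\in\rho\Rightarrow(am,bm)\in\rho$ for all $m\in M$. For a subact $B$ of $A$, the Rees quotient $A/B$ is the quotient of $A$ by the congruence $a\,\rho_B\,b\iff a=b$ or $a,b\in B$. For a set $X$, $F_X=X\times M$ is the free $M$-act with $(x,m)n=(x,mn)$. A presentation $\langle X\,|\,R\rangle$ consists of a non-empty set $X$ and a set $R\subseteq F_X\times F_X$; an $M$-act is defined by it if it is isomorphic to $F_X/\rho$, where $\rho$ is the smallest congruence on $F_X$ containing $R$. An $M$-act is finitely presented if it is defined by some presentation $\langle X\,|\,R\rangle$ with $X$ and $R$ finite. *)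

theory Defs
  imports "HOL-Algebra.Group"
begin

record ('a, 'm) act = "'a partial_object" +
  action :: "'a \<Rightarrow> 'm \<Rightarrow> 'a" (infixl "\<cdot>\<index>" 70)

locale monoid_act = monoid M for M :: "('m, 'z) monoid_scheme" (structure) +
  fixes A :: "('a, 'm) act"
  assumes nonempty: "carrier A \<noteq> {}"
    and action_closed: "\<lbrakk>a \<in> carrier A; m \<in> carrier M\<rbrakk> \<Longrightarrow> a \<cdot>\<^bsub>A\<^esub> m \<in> carrier A"
    and action_mult: "\<lbrakk>a \<in> carrier A; m \<in> carrier M; n \<in> carrier M\<rbrakk>
      \<Longrightarrow> a \<cdot>\<^bsub>A\<^esub> (m \<otimes> n) = (a \<cdot>\<^bsub>A\<^esub> m) \<cdot>\<^bsub>A\<^esub> n"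
    and action_one: "a \<in> carrier A \<Longrightarrow> a \<cdot>\<^bsub>A\<^esub> \<one> = a"

definition subact :: "('m, 'z) monoid_scheme \<Rightarrow> ('a, 'm) act \<Rightarrow> 'a set \<Rightarrow> bool" where
  "subact M A B \<longleftrightarrow> B \<subseteq> carrier A \<and> B \<noteq> {} \<and>
     (\<forall>b\<in>B. \<forall>m\<in>carrier M. b \<cdot>\<^bsub>A\<^esub> m \<in> B)"

definition generates :: "('m, 'z) monoid_scheme \<Rightarrow> ('a, 'm) act \<Rightarrow> 'a set \<Rightarrow> bool" where
  "generates M A U \<longleftrightarrow> U \<subseteq> carrier A \<and>
     (\<forall>a\<in>carrier A. \<exists>u\<in>U. \<exists>m\<in>carrier M. a = u \<cdot>\<^bsub>A\<^esub> m)"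

definition finitely_generated_act :: "('m, 'z) monoid_scheme \<Rightarrow> ('a, 'm) act \<Rightarrow> bool" where
  "finitely_generated_act M A \<longleftrightarrow> (\<exists>U. finite U \<and> generates M A U)"

definition act_congruence ::
    "('m, 'z) monoid_scheme \<Rightarrow> ('a, 'm) act \<Rightarrow> ('a \<times> 'a) set \<Rightarrow> bool" where
  "act_congruence M A \<rho> \<longleftrightarrow> equiv (carrier A) \<rho> \<and>
     (\<forall>(a, b)\<in>\<rho>. \<forall>m\<in>carrier M. (a \<cdot>\<^bsub>A\<^esub> m, b \<cdot>\<^bsub>A\<^esub> m) \<in> \<rho>)"

text \<open>When \<open>\<rho>\<close> is a congruence, all members of the union below coincide, so that the class
  of \<open>a\<close> times \<open>m\<close> is the class of \<open>a \<cdot> m\<close>.\<close>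

definition quotient_act :: "('a, 'm) act \<Rightarrow> ('a \<times> 'a) set \<Rightarrow> ('a set, 'm) act" where
  "quotient_act A \<rho> =
     \<lparr>carrier = carrier A // \<rho>, action = (\<lambda>C m. \<Union>a\<in>C. \<rho> `` {a \<cdot>\<^bsub>A\<^esub> m})\<rparr>"

definition rees_congruence :: "('a, 'm) act \<Rightarrow> 'a set \<Rightarrow> ('a \<times> 'a) set" where
  "rees_congruence A B =
     {(a, b). a \<in> carrier A \<and> b \<in> carrier A \<and> (a = b \<or> a \<in> B \<and> b \<in> B)}"

definition rees_quotient :: "('a, 'm) act \<Rightarrow> 'a set \<Rightarrow> ('a set, 'm) act" where
  "rees_quotient A B = quotient_act A (rees_congruence A B)"

definition free_act :: "('m, 'z) monoid_scheme \<Rightarrow> 'x set \<Rightarrow> ('x \<times> 'm, 'm) act" where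
  "free_act M X =
     \<lparr>carrier = X \<times> carrier M, action = (\<lambda>(x, m) n. (x, m \<otimes>\<^bsub>M\<^esub> n))\<rparr>"

definition generated_congruence ::
    "('m, 'z) monoid_scheme \<Rightarrow> ('a, 'm) act \<Rightarrow> ('a \<times> 'a) set \<Rightarrow> ('a \<times> 'a) set" where
  "generated_congruence M A R = \<Inter>{\<rho>. act_congruence M A \<rho> \<and> R \<subseteq> \<rho>}"

definition act_hom ::
    "('m, 'z) monoid_scheme \<Rightarrow> ('a, 'm) act \<Rightarrow> ('b, 'm) act \<Rightarrow> ('a \<Rightarrow> 'b) set" where
  "act_hom M A B = {f \<in> carrier A \<rightarrow> carrier B.
     \<forall>a\<in>carrier A. \<forall>m\<in>carrier M. f (a \<cdot>\<^bsub>A\<^esub> m) = f a \<cdot>\<^bsub>B\<^esub> m}"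

definition act_isomorphic ::
    "('m, 'z) monoid_scheme \<Rightarrow> ('a, 'm) act \<Rightarrow> ('b, 'm) act \<Rightarrow> bool" where
  "act_isomorphic M A B \<longleftrightarrow> (\<exists>f\<in>act_hom M A B. bij_betw f (carrier A) (carrier B))"

definition presentation ::
    "('m, 'z) monoid_scheme \<Rightarrow> 'x set \<Rightarrow> (('x \<times> 'm) \<times> ('x \<times> 'm)) set \<Rightarrow> bool" where
  "presentation M X R \<longleftrightarrow>
     X \<noteq> {} \<and> R \<subseteq> carrier (free_act M X) \<times> carrier (free_act M X)"

definition defined_by ::
    "('m, 'z) monoid_scheme \<Rightarrow> ('a, 'm) act \<Rightarrow> 'x set \<Rightarrow> (('x \<times> 'm) \<times> ('x \<times> 'm)) set \<Rightarrow> bool"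
  where
  "defined_by M A X R \<longleftrightarrow> presentation M X R \<and>
     act_isomorphic M A
       (quotient_act (free_act M X) (generated_congruence M (free_act M X) R))"

text \<open>A definition cannot quantify over the type of the generating symbols. Since \<open>X\<close> is finite
  and only matters up to renaming its elements, taking symbols from \<^typ>\<open>nat\<close> loses no
  generality.\<close>

definition finitely_presented_act :: "('m, 'z) monoid_scheme \<Rightarrow> ('a, 'm) act \<Rightarrow> bool" where
  "finitely_presented_act M A \<longleftrightarrow>
     (\<exists>(X :: nat set) R. finite X \<and> finite R \<and> defined_by M A X R)"

definition trivial_act :: "(unit, 'm) act" where
  "trivial_act = \<lparr>carrier = {()}, action = (\<lambda>_ _. ())\<rparr>"

definition finitely_generated_monoid :: "('m, 'z) monoid_scheme \<Rightarrow> bool" where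
  "finitely_generated_monoid M \<longleftrightarrow>
     (\<exists>S \<subseteq> carrier M. finite S \<and> \<Inter>{H. submonoid H M \<and> S \<subseteq> H} = carrier M)"

end

theory Submission
  imports Defs
begin

text \<open>A presentation of an act \<open>A\<close> amounts to a surjective homomorphism \<open>\<phi>\<close> from a free act
  whose kernel is generated by the relations.

  If \<open>A/B\<close> is finitely presented, then so is the trivial act: the class of \<open>B\<close> is a zero of
  \<open>A/B\<close>, and adding to a presentation the finitely many relations that equate each generator with
  a word for this zero collapses everything.

  Conversely, let \<open>\<langle>Y|S\<rangle>\<close> present the trivial act, and let \<open>v\<close> range over words for the finitely
  many generators of \<open>B\<close>. To a presentation of \<open>A\<close> add the relations \<open>v = v'\<close>, and \<open>v p = v q\<close>
  for each relation \<open>(y, p) = (z, q)\<close> of \<open>S\<close>. The homomorphism \<open>(y, m) \<mapsto> v m\<close> carries \<open>S\<close> into the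
  resulting congruence, hence also carries the universal congruence of \<open>F\<^sub>Y\<close> into it, so that
  \<open>v m = v n\<close> for all \<open>m\<close> and \<open>n\<close>.\<close>

section \<open>Congruences, kernels and homomorphisms of acts\<close>

definition act_kernel :: "('a, 'm) act \<Rightarrow> ('a \<Rightarrow> 'b) \<Rightarrow> ('a \<times> 'a) set" where
  "act_kernel A f = {(a, b). a \<in> carrier A \<and> b \<in> carrier A \<and> f a = f b}"

lemma act_congruenceI:
  assumes "\<rho> \<subseteq> carrier A \<times> carrier A"
    and "\<And>a. a \<in> carrier A \<Longrightarrow> (a, a) \<in> \<rho>"
    and "\<And>a b. (a, b) \<in> \<rho> \<Longrightarrow> (b, a) \<in> \<rho>"
    and "\<And>a b c. (a, b) \<in> \<rho> \<Longrightarrow> (b, c) \<in> \<rho> \<Longrightarrow> (a, c) \<in> \<rho>"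
    and "\<And>a b m. (a, b) \<in> \<rho> \<Longrightarrow> m \<in> carrier M \<Longrightarrow> (a \<cdot>\<^bsub>A\<^esub> m, b \<cdot>\<^bsub>A\<^esub> m) \<in> \<rho>"
  shows "act_congruence M A \<rho>"
proof -
  have "equiv (carrier A) \<rho>"
    by (intro equivI refl_onI symI transI) (fact assms)+
  then show ?thesis
    using assms(5) by (auto simp: act_congruence_def)
qed

lemma act_congruenceD:
  assumes "act_congruence M A \<rho>"
  shows "equiv (carrier A) \<rho>"
    and "\<rho> \<subseteq> carrier A \<times> carrier A"
    and "a \<in> carrier A \<Longrightarrow> (a, a) \<in> \<rho>"
    and "(a, b) \<in> \<rho> \<Longrightarrow> (b, a) \<in> \<rho>"
    and "(a, b) \<in> \<rho> \<Longrightarrow> (b, c) \<in> \<rho> \<Longrightarrow> (a, c) \<in> \<rho>"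
    and "(a, b) \<in> \<rho> \<Longrightarrow> m \<in> carrier M \<Longrightarrow> (a \<cdot>\<^bsub>A\<^esub> m, b \<cdot>\<^bsub>A\<^esub> m) \<in> \<rho>"
proof -
  show \<rho>: "equiv (carrier A) \<rho>"
    using assms by (simp add: act_congruence_def)
  show "\<rho> \<subseteq> carrier A \<times> carrier A"
    using \<rho> by (rule equiv_type)
  show "a \<in> carrier A \<Longrightarrow> (a, a) \<in> \<rho>"
    using \<rho> by (auto simp: equiv_def dest: refl_onD)
  show "(a, b) \<in> \<rho> \<Longrightarrow> (b, a) \<in> \<rho>"
    using \<rho> by (auto simp: equiv_def dest: symD)
  show "(a, b) \<in> \<rho> \<Longrightarrow> (b, c) \<in> \<rho> \<Longrightarrow> (a, c) \<in> \<rho>"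
    using \<rho> by (auto simp: equiv_def dest: transD)
  show "(a, b) \<in> \<rho> \<Longrightarrow> m \<in> carrier M \<Longrightarrow> (a \<cdot>\<^bsub>A\<^esub> m, b \<cdot>\<^bsub>A\<^esub> m) \<in> \<rho>"
    using assms by (auto simp: act_congruence_def)
qed

lemma act_homD:
  assumes "f \<in> act_hom M A B" "a \<in> carrier A"
  shows "f a \<in> carrier B"
    and "m \<in> carrier M \<Longrightarrow> f (a \<cdot>\<^bsub>A\<^esub> m) = f a \<cdot>\<^bsub>B\<^esub> m"
  using assms unfolding act_hom_def by auto

lemma generated_congruence_superset: "R \<subseteq> generated_congruence M A R"
  unfolding generated_congruence_def by blast

lemma generated_congruence_least:
  "act_congruence M A \<rho> \<Longrightarrow> R \<subseteq> \<rho> \<Longrightarrow> generated_congruence M A R \<subseteq> \<rho>"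
  unfolding generated_congruence_def by blast

section \<open>Generated congruences and quotients of a fixed act\<close>

context monoid_act
begin

lemma act_congruence_universal: "act_congruence M A (carrier A \<times> carrier A)"
  by (rule act_congruenceI) (auto simp: action_closed)

text \<open>Every congruence law passes to intersections. The hypothesis on \<open>R\<close> puts
  the universal congruence into the intersected family, so the family is non-empty and its
  intersection stays inside the carrier.\<close>

lemma act_congruence_generated:
  assumes "R \<subseteq> carrier A \<times> carrier A"
  shows "act_congruence M A (generated_congruence M A R)"
proof -
  let ?C = "{\<rho>. act_congruence M A \<rho> \<and> R \<subseteq> \<rho>}"
  have C: "act_congruence M A \<rho>" if "\<rho> \<in> ?C" for \<rho>
    using that by simp
  have "carrier A \<times> carrier A \<in> ?C"
    using act_congruence_universal assms by simp
  then show ?thesis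
    unfolding generated_congruence_def
    by (intro act_congruenceI Inter_lower InterI)
      (blast intro: act_congruenceD(3-6)[OF C])+
qed

lemma act_congruence_kernel:
  assumes "f \<in> act_hom M A C"
  shows "act_congruence M A (act_kernel A f)"
  using assms by (intro act_congruenceI) (auto simp: act_kernel_def act_homD action_closed)

lemma quotient_action:
  assumes \<rho>: "act_congruence M A \<rho>" and a: "a \<in> carrier A" and m: "m \<in> carrier M"
  shows "(\<rho> `` {a}) \<cdot>\<^bsub>quotient_act A \<rho>\<^esub> m = \<rho> `` {a \<cdot>\<^bsub>A\<^esub> m}"
proof -
  have "(\<Union>b\<in>\<rho> `` {a}. \<rho> `` {b \<cdot>\<^bsub>A\<^esub> m}) = \<rho> `` {a \<cdot>\<^bsub>A\<^esub> m}"
  proof (rule UN_constant_eq)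
    show "a \<in> \<rho> `` {a}"
      using act_congruenceD(3)[OF \<rho> a] by blast
    show "\<forall>b\<in>\<rho> `` {a}. \<rho> `` {b \<cdot>\<^bsub>A\<^esub> m} = \<rho> `` {a \<cdot>\<^bsub>A\<^esub> m}"
      using equiv_class_eq[OF act_congruenceD(1)[OF \<rho>]] act_congruenceD(6)[OF \<rho> _ m] by blast
  qed
  then show ?thesis
    by (simp add: quotient_act_def)
qed

lemma carrier_quotient_act: "carrier (quotient_act A \<rho>) = (\<lambda>a. \<rho> `` {a}) ` carrier A"
  by (auto simp: quotient_act_def quotient_def)

lemma projection_eq_iff:
  assumes "act_congruence M A \<rho>" "a \<in> carrier A" "b \<in> carrier A"
  shows "\<rho> `` {a} = \<rho> `` {b} \<longleftrightarrow> (a, b) \<in> \<rho>"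
  using eq_equiv_class_iff[OF act_congruenceD(1)] assms by fast

lemma monoid_act_quotient:
  assumes "act_congruence M A \<rho>"
  shows "monoid_act M (quotient_act A \<rho>)"
proof
  show "carrier (quotient_act A \<rho>) \<noteq> {}"
    by (simp add: carrier_quotient_act nonempty)
next
  fix C m assume "C \<in> carrier (quotient_act A \<rho>)" and m: "m \<in> carrier M"
  then obtain a where a: "a \<in> carrier A" "C = \<rho> `` {a}"
    by (auto simp: carrier_quotient_act)
  show "C \<cdot>\<^bsub>quotient_act A \<rho>\<^esub> m \<in> carrier (quotient_act A \<rho>)"
    unfolding a(2) quotient_action[OF assms a(1) m] carrier_quotient_act
    using a(1) m by (intro imageI action_closed)
next
  fix C m n assume "C \<in> carrier (quotient_act A \<rho>)" and mn: "m \<in> carrier M" "n \<in> carrier M"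
  then obtain a where a: "a \<in> carrier A" "C = \<rho> `` {a}"
    by (auto simp: carrier_quotient_act)
  then show "C \<cdot>\<^bsub>quotient_act A \<rho>\<^esub> (m \<otimes> n)
      = (C \<cdot>\<^bsub>quotient_act A \<rho>\<^esub> m) \<cdot>\<^bsub>quotient_act A \<rho>\<^esub> n"
    using mn by (simp add: quotient_action[OF assms] action_closed action_mult)
next
  fix C assume "C \<in> carrier (quotient_act A \<rho>)"
  then obtain a where a: "a \<in> carrier A" "C = \<rho> `` {a}"
    by (auto simp: carrier_quotient_act)
  then show "C \<cdot>\<^bsub>quotient_act A \<rho>\<^esub> \<one> = C"
    by (simp add: quotient_action[OF assms] action_one)
qed

lemma act_congruence_rees:
  assumes "subact M A B"
  shows "act_congruence M A (rees_congruence A B)"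
  using assms by (intro act_congruenceI) (auto simp: rees_congruence_def subact_def action_closed)

end

section \<open>Presentations as surjections from free acts\<close>

context monoid
begin

lemma monoid_act_free: "X \<noteq> {} \<Longrightarrow> monoid_act G (free_act G X)"
  by unfold_locales (auto simp: free_act_def m_assoc)

text \<open>Existence half of the universal property of the free act: any assignment
  \<open>g\<close> of generators extends to a homomorphism.\<close>

lemma free_hom:
  assumes A: "monoid_act G A" and g: "g \<in> X \<rightarrow> carrier A"
  shows "(\<lambda>(x, m). g x \<cdot>\<^bsub>A\<^esub> m) \<in> act_hom G (free_act G X) A"
  using g unfolding act_hom_def free_act_def
  by (auto intro!: monoid_act.action_closed[OF A] simp: monoid_act.action_mult[OF A] Pi_iff)

text \<open>First isomorphism theorem, packaged so that later proofs compare a generated congruence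
  with a kernel and need not build an isomorphism onto a quotient.\<close>

lemma finitely_presented_actI:
  fixes X :: "nat set"
  assumes X: "finite X" "X \<noteq> {}" and R: "finite R"
      "R \<subseteq> carrier (free_act G X) \<times> carrier (free_act G X)"
    and hom: "\<phi> \<in> act_hom G (free_act G X) A"
    and surj: "\<phi> ` carrier (free_act G X) = carrier A"
    and ker: "generated_congruence G (free_act G X) R = act_kernel (free_act G X) \<phi>"
  shows "finitely_presented_act G A"
proof -
  define F where "F = free_act G X"
  note R = R[folded F_def] and hom = hom[folded F_def] and surj = surj[folded F_def]
    and ker = ker[folded F_def]
  interpret F: monoid_act G F
    unfolding F_def using X(2) by (rule monoid_act_free)
  let ?\<rho> = "act_kernel F \<phi>"
  have \<rho>: "act_congruence G F ?\<rho>"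
    using hom by (rule F.act_congruence_kernel)
  \<comment> \<open>The fibre of \<open>\<phi>\<close> over \<open>a\<close> is a whole kernel
    class, so no representative has to be chosen. This map is the inverse of the bijection that
    \<open>\<phi>\<close> induces, and it points from \<open>A\<close> to the quotient, as
    \<open>defined_by\<close> demands.\<close>
  define f where "f a = {w \<in> carrier F. \<phi> w = a}" for a
  have f: "f (\<phi> w) = ?\<rho> `` {w}" if "w \<in> carrier F" for w
    using that by (auto simp: f_def act_kernel_def)
  have "f (\<phi> w \<cdot>\<^bsub>A\<^esub> m) = f (\<phi> w) \<cdot>\<^bsub>quotient_act F ?\<rho>\<^esub> m"
    if "w \<in> carrier F" "m \<in> carrier G" for w m
    unfolding act_homD(2)[OF hom that, symmetric] using that
    by (simp add: f F.action_closed F.quotient_action[OF \<rho>])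
  then have "f \<in> act_hom G A (quotient_act F ?\<rho>)"
    unfolding act_hom_def surj[symmetric]
    by (simp add: Pi_iff f F.carrier_quotient_act)
  moreover have "bij_betw f (carrier A) (carrier (quotient_act F ?\<rho>))"
    unfolding bij_betw_def
  proof
    show "inj_on f (carrier A)"
      unfolding surj[symmetric] by (rule inj_onI) (auto simp: f_def)
    show "f ` carrier A = carrier (quotient_act F ?\<rho>)"
      unfolding surj[symmetric] by (simp add: image_image f F.carrier_quotient_act)
  qed
  ultimately show ?thesis
    unfolding finitely_presented_act_def defined_by_def presentation_def act_isomorphic_def
    using X R ker unfolding F_def by metis
qed

text \<open>Converse of the previous lemma: \<open>\<phi>\<close> is the projection of the free act
  onto its quotient, followed by the inverse of the given isomorphism.\<close>

lemma finitely_presented_actE: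
  assumes A: "monoid_act G A" and "finitely_presented_act G A"
  obtains X :: "nat set" and R \<phi> where "finite X" "X \<noteq> {}" "finite R"
    "R \<subseteq> carrier (free_act G X) \<times> carrier (free_act G X)"
    "\<phi> \<in> act_hom G (free_act G X) A" "\<phi> ` carrier (free_act G X) = carrier A"
    "generated_congruence G (free_act G X) R = act_kernel (free_act G X) \<phi>"
proof -
  interpret A: monoid_act G A by fact
  obtain X :: "nat set" and R f where X: "finite X" "X \<noteq> {}" and R: "finite R"
      "R \<subseteq> carrier (free_act G X) \<times> carrier (free_act G X)"
    and f: "f \<in> act_hom G A (quotient_act (free_act G X) (generated_congruence G (free_act G X) R))"
    and bij: "bij_betw f (carrier A)
      (carrier (quotient_act (free_act G X) (generated_congruence G (free_act G X) R)))"
    using assms(2)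
    unfolding finitely_presented_act_def defined_by_def presentation_def act_isomorphic_def by blast
  define F where "F = free_act G X"
  define \<rho> where "\<rho> = generated_congruence G F R"
  interpret F: monoid_act G F
    unfolding F_def using X(2) by (rule monoid_act_free)
  have \<rho>: "act_congruence G F \<rho>"
    unfolding \<rho>_def using R(2) by (intro F.act_congruence_generated) (simp add: F_def)
  note f = f[folded F_def, folded \<rho>_def] and bij = bij[folded F_def, folded \<rho>_def]
  define g where "g = inv_into (carrier A) f"
  define \<phi> where "\<phi> w = g (\<rho> `` {w})" for w
  have bij_g: "bij_betw g (carrier (quotient_act F \<rho>)) (carrier A)"
    unfolding g_def using bij by (rule bij_betw_inv_into)
  have \<phi>_closed: "\<phi> w \<in> carrier A" if "w \<in> carrier F" for w
    using that bij_betwE[OF bij_g] by (simp add: \<phi>_def F.carrier_quotient_act)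
  have f_\<phi>: "f (\<phi> w) = \<rho> `` {w}" if "w \<in> carrier F" for w
    using that bij_betw_inv_into_right[OF bij] by (simp add: \<phi>_def g_def F.carrier_quotient_act)
  \<comment> \<open>Both sides are compared after applying the injective homomorphism
    \<open>f\<close>, so that no separate proof is needed that its inverse \<open>g\<close> respects
    the action.\<close>
  have "\<phi> (w \<cdot>\<^bsub>F\<^esub> m) = \<phi> w \<cdot>\<^bsub>A\<^esub> m" if "w \<in> carrier F" "m \<in> carrier G" for w m
  proof (rule inj_onD[OF bij_betw_imp_inj_on[OF bij]])
    show "f (\<phi> (w \<cdot>\<^bsub>F\<^esub> m)) = f (\<phi> w \<cdot>\<^bsub>A\<^esub> m)"
      using that
      by (simp add: f_\<phi> F.action_closed act_homD(2)[OF f \<phi>_closed] F.quotient_action[OF \<rho>])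
  qed (use that \<phi>_closed F.action_closed A.action_closed in auto)
  then have hom: "\<phi> \<in> act_hom G F A"
    using \<phi>_closed by (simp add: act_hom_def)
  have surj: "\<phi> ` carrier F = carrier A"
    using bij_betw_imp_surj_on[OF bij_g] by (simp add: \<phi>_def F.carrier_quotient_act image_image)
  have "\<phi> w = \<phi> w' \<longleftrightarrow> (w, w') \<in> \<rho>" if "w \<in> carrier F" "w' \<in> carrier F" for w w'
    using that f_\<phi> F.projection_eq_iff[OF \<rho>] by (metis \<phi>_def)
  then have ker: "\<rho> = act_kernel F \<phi>"
    using act_congruenceD(2)[OF \<rho>] by (auto simp: act_kernel_def)
  show thesis
    using that X R hom surj ker unfolding F_def \<rho>_def by blast
qed

section \<open>Presentations of the trivial act\<close>

lemma monoid_act_trivial: "monoid_act G trivial_act"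
  by unfold_locales (auto simp: trivial_act_def)

text \<open>If all words are congruent to one word \<open>c\<close>, then the generated congruence
  is universal, hence the kernel of the constant map.\<close>

lemma finitely_presented_trivial_actI:
  fixes X :: "nat set"
  assumes "finite X" "X \<noteq> {}" "finite R"
    "R \<subseteq> carrier (free_act G X) \<times> carrier (free_act G X)"
    and collapse: "\<And>w. w \<in> carrier (free_act G X) \<Longrightarrow>
      (w, c) \<in> generated_congruence G (free_act G X) R"
  shows "finitely_presented_act G trivial_act"
proof (rule finitely_presented_actI[where \<phi> = "\<lambda>_. ()"])
  interpret F: monoid_act G "free_act G X"
    using assms(2) by (rule monoid_act_free)
  note \<sigma> = F.act_congruence_generated[OF assms(4)]
  show "generated_congruence G (free_act G X) R = act_kernel (free_act G X) (\<lambda>_. ())"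
    using act_congruenceD(2)[OF \<sigma>] act_congruenceD(5)[OF \<sigma> collapse act_congruenceD(4)[OF \<sigma> collapse]]
    by (auto simp: act_kernel_def)
  show "(\<lambda>_. ()) ` carrier (free_act G X) = carrier trivial_act"
    using F.nonempty by (auto simp: trivial_act_def)
qed (use assms in \<open>auto simp: act_hom_def trivial_act_def\<close>)

text \<open>Let \<open>c\<close> be a word for the zero \<open>z\<close>, and add the relations
  \<open>(x, \<one>) = c\<close>. A word \<open>(x, m)\<close> is then congruent to \<open>c\<close>
  acted on by \<open>m\<close>, and this to \<open>c\<close>, because both represent
  \<open>z\<close>.\<close>

lemma finitely_presented_trivial_if_zero:
  assumes A: "monoid_act G A" and fp: "finitely_presented_act G A"
    and z: "z \<in> carrier A" "\<And>m. m \<in> carrier G \<Longrightarrow> z \<cdot>\<^bsub>A\<^esub> m = z"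
  shows "finitely_presented_act G trivial_act"
proof -
  obtain X :: "nat set" and R \<phi> where X: "finite X" "X \<noteq> {}" and R: "finite R"
      "R \<subseteq> carrier (free_act G X) \<times> carrier (free_act G X)"
    and hom: "\<phi> \<in> act_hom G (free_act G X) A"
    and surj: "\<phi> ` carrier (free_act G X) = carrier A"
    and ker: "generated_congruence G (free_act G X) R = act_kernel (free_act G X) \<phi>"
    using A fp by (rule finitely_presented_actE)
  define F where "F = free_act G X"
  note hom = hom[folded F_def] and surj = surj[folded F_def] and ker = ker[folded F_def]
  interpret F: monoid_act G F
    unfolding F_def using X(2) by (rule monoid_act_free)
  obtain c where c: "c \<in> carrier F" "\<phi> c = z"
    using z(1) unfolding surj[symmetric] by (rule imageE) auto
  define R' where "R' = R \<union> (\<lambda>x. ((x, \<one>), c)) ` X"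
  have R': "R' \<subseteq> carrier F \<times> carrier F"
    using R(2) c(1) by (auto simp: R'_def F_def free_act_def)
  define \<sigma> where "\<sigma> = generated_congruence G F R'"
  have \<sigma>: "act_congruence G F \<sigma>"
    unfolding \<sigma>_def using R' by (rule F.act_congruence_generated)
  have R'_\<sigma>: "R' \<subseteq> \<sigma>"
    unfolding \<sigma>_def by (rule generated_congruence_superset)
  \<comment> \<open>The old relations are among the new ones, so equalities that hold in
    \<open>A\<close> hold modulo \<open>\<sigma>\<close>.\<close>
  have ker_\<sigma>: "act_kernel F \<phi> \<subseteq> \<sigma>"
    unfolding ker[symmetric] using R'_\<sigma> by (intro generated_congruence_least[OF \<sigma>]) (auto simp: R'_def)
  have "(w, c) \<in> \<sigma>" if w_F: "w \<in> carrier F" for w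
  proof -
    obtain x m where "w = (x, m)" and x: "x \<in> X" and m: "m \<in> carrier G"
      using w_F by (auto simp: F_def free_act_def)
    then have w: "w = (x, \<one>) \<cdot>\<^bsub>F\<^esub> m"
      by (simp add: F_def free_act_def)
    have "(w, c \<cdot>\<^bsub>F\<^esub> m) \<in> \<sigma>"
      unfolding w using R'_\<sigma> x m by (intro act_congruenceD(6)[OF \<sigma>]) (auto simp: R'_def)
    moreover have "(c \<cdot>\<^bsub>F\<^esub> m, c) \<in> \<sigma>"
    proof (rule subsetD[OF ker_\<sigma>])
      show "(c \<cdot>\<^bsub>F\<^esub> m, c) \<in> act_kernel F \<phi>"
        using c m z(2) by (simp add: act_kernel_def act_homD(2)[OF hom] F.action_closed)
    qed
    ultimately show ?thesis
      by (rule act_congruenceD(5)[OF \<sigma>])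
  qed
  then show ?thesis
    using X R(1) R' unfolding \<sigma>_def F_def
    by (intro finitely_presented_trivial_actI[of X R' c]) (auto simp: R'_def)
qed

section \<open>The two directions for Rees quotients\<close>

lemma finitely_presented_trivial_if_rees_quotient:
  assumes A: "monoid_act G A" and B: "subact G A B"
    and fp: "finitely_presented_act G (rees_quotient A B)"
  shows "finitely_presented_act G trivial_act"
proof -
  interpret A: monoid_act G A by fact
  note \<rho> = A.act_congruence_rees[OF B]
  obtain b where b: "b \<in> B" "b \<in> carrier A"
    using B by (auto simp: subact_def)
  let ?z = "rees_congruence A B `` {b}"
  have "?z \<cdot>\<^bsub>rees_quotient A B\<^esub> m = ?z" if "m \<in> carrier G" for m
  proof -
    have "(b \<cdot>\<^bsub>A\<^esub> m, b) \<in> rees_congruence A B"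
      using B b that by (auto simp: subact_def rees_congruence_def)
    then show ?thesis
      using A.quotient_action[OF \<rho> b(2) that] b that
      by (simp add: rees_quotient_def A.projection_eq_iff[OF \<rho>] A.action_closed)
  qed
  then show ?thesis
    using fp A.monoid_act_quotient[OF \<rho>] b(2) A.carrier_quotient_act
    by (intro finitely_presented_trivial_if_zero[of "rees_quotient A B" ?z])
      (auto simp: rees_quotient_def)
qed

text \<open>The enlarged set of relations generates a congruence \<open>\<sigma>\<close> that is
  shown to be the kernel of the composite \<open>\<psi>\<close> from the free act through
  \<open>A\<close> onto \<open>A/B\<close>. Each relation holds in \<open>A\<close> or links two
  words for members of \<open>B\<close>, so \<open>\<sigma>\<close> lies in the kernel. Conversely,
  \<open>\<sigma>\<close> identifies all words for members of \<open>B\<close>.\<close>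

lemma finitely_presented_rees_quotient:
  assumes A: "monoid_act G A" and fp: "finitely_presented_act G A"
    and B: "subact G A B" and fg: "finitely_generated_act G (A\<lparr>carrier := B\<rparr>)"
    and triv: "finitely_presented_act G (trivial_act :: (unit, 'a) act)"
  shows "finitely_presented_act G (rees_quotient A B)"
proof -
  interpret A: monoid_act G A by fact
  let ?\<rho> = "rees_congruence A B"
  note \<rho> = A.act_congruence_rees[OF B]
  obtain X :: "nat set" and R \<phi> where X: "finite X" "X \<noteq> {}" and R: "finite R"
      "R \<subseteq> carrier (free_act G X) \<times> carrier (free_act G X)"
    and hom: "\<phi> \<in> act_hom G (free_act G X) A"
    and surj: "\<phi> ` carrier (free_act G X) = carrier A"
    and ker: "generated_congruence G (free_act G X) R = act_kernel (free_act G X) \<phi>"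
    using A fp by (rule finitely_presented_actE)
  define F where "F = free_act G X"
  note R = R[folded F_def] and hom = hom[folded F_def] and surj = surj[folded F_def]
    and ker = ker[folded F_def]
  interpret F: monoid_act G F
    unfolding F_def using X(2) by (rule monoid_act_free)
  \<comment> \<open>As \<open>\<theta>\<close> takes values in \<open>unit\<close>, its kernel is
    the universal congruence: \<open>S\<close> identifies all words over \<open>Y\<close>.\<close>
  obtain Y :: "nat set" and S and \<theta> :: "nat \<times> 'a \<Rightarrow> unit"
    where Y: "Y \<noteq> {}" and S: "finite S"
      "S \<subseteq> carrier (free_act G Y) \<times> carrier (free_act G Y)"
    and kerY: "generated_congruence G (free_act G Y) S = act_kernel (free_act G Y) \<theta>"
    using monoid_act_trivial triv by (rule finitely_presented_actE)
  obtain U where U: "finite U" "U \<subseteq> B"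
    and U_gen: "\<And>b. b \<in> B \<Longrightarrow> \<exists>u\<in>U. \<exists>m\<in>carrier G. b = u \<cdot>\<^bsub>A\<^esub> m"
    using fg by (auto simp: finitely_generated_act_def generates_def)
  have B_sub: "B \<subseteq> carrier A" and B_closed: "\<And>b m. b \<in> B \<Longrightarrow> m \<in> carrier G \<Longrightarrow> b \<cdot>\<^bsub>A\<^esub> m \<in> B"
    using B by (auto simp: subact_def)
  \<comment> \<open>\<open>V\<close> is a finite set of words that \<open>\<phi>\<close> maps onto
    the generating set \<open>U\<close> of \<open>B\<close>.\<close>
  obtain V where V: "V \<subseteq> carrier F" "finite V" "\<phi> ` V = U"
    using finite_subset_image[OF U(1), of \<phi> "carrier F"] U(2) B_sub surj by auto

  \<comment> \<open>The symbols of \<open>Y\<close> are dropped from the pairs in \<open>S\<close>,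
    since each of them is to be replaced by the same word \<open>v\<close>.\<close>
  define R' where
    "R' = R \<union> V \<times> V \<union> (\<lambda>(v, ((_, p), (_, q))). (v \<cdot>\<^bsub>F\<^esub> p, v \<cdot>\<^bsub>F\<^esub> q)) ` (V \<times> S)"
  have finR': "finite R'"
    unfolding R'_def using R(1) V(2) S(1) by simp
  have S_carrier: "p \<in> carrier G \<and> q \<in> carrier G" if "((y, p), (z, q)) \<in> S" for y p z q
    using that S(2) by (auto simp: free_act_def)
  have R': "R' \<subseteq> carrier F \<times> carrier F"
    using R(2) V(1) S_carrier by (auto simp: R'_def intro!: F.action_closed)
  define \<sigma> where "\<sigma> = generated_congruence G F R'"
  have \<sigma>: "act_congruence G F \<sigma>"
    unfolding \<sigma>_def using R' by (rule F.act_congruence_generated)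
  have R'_\<sigma>: "R' \<subseteq> \<sigma>"
    unfolding \<sigma>_def by (rule generated_congruence_superset)
  have ker_\<sigma>: "act_kernel F \<phi> \<subseteq> \<sigma>"
    unfolding ker[symmetric] using R'_\<sigma> by (intro generated_congruence_least[OF \<sigma>]) (auto simp: R'_def)

  have v_collapse: "(v \<cdot>\<^bsub>F\<^esub> m, v) \<in> \<sigma>" if v: "v \<in> V" and m: "m \<in> carrier G" for v m
  proof -
    interpret FY: monoid_act G "free_act G Y"
      using Y by (rule monoid_act_free)
    interpret Q: monoid_act G "quotient_act F \<sigma>"
      using \<sigma> by (rule F.monoid_act_quotient)
    have v': "v \<in> carrier F"
      using v V(1) by blast
    \<comment> \<open>The homomorphism from the free act on \<open>Y\<close> to the quotient by
      \<open>\<sigma>\<close> that sends every symbol to the class of \<open>v\<close>. The third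
      family of relations in \<open>R'\<close> puts \<open>S\<close> into its kernel, which is
      therefore universal.\<close>
    define h where "h = (\<lambda>(y :: nat, n). (\<sigma> `` {v}) \<cdot>\<^bsub>quotient_act F \<sigma>\<^esub> n)"
    have h: "h \<in> act_hom G (free_act G Y) (quotient_act F \<sigma>)"
      unfolding h_def using v' F.carrier_quotient_act
      by (intro free_hom Q.monoid_act_axioms) auto
    have h_eq: "h (y, n) = \<sigma> `` {v \<cdot>\<^bsub>F\<^esub> n}" if "n \<in> carrier G" for y n
      using F.quotient_action[OF \<sigma> v' that] by (simp add: h_def)
    have "S \<subseteq> act_kernel (free_act G Y) h"
    proof
      fix s assume s: "s \<in> S"
      obtain y p z q where s_eq: "s = ((y, p), (z, q))"
        by (metis prod.collapse)
      have pq: "p \<in> carrier G" "q \<in> carrier G"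
        using S_carrier s s_eq by auto
      have "(v \<cdot>\<^bsub>F\<^esub> p, v \<cdot>\<^bsub>F\<^esub> q) \<in> \<sigma>"
        using R'_\<sigma> s v unfolding R'_def s_eq by (force simp: image_iff)
      then have "h (y, p) = h (z, q)"
        using pq v' by (simp add: h_eq F.projection_eq_iff[OF \<sigma>] F.action_closed)
      then show "s \<in> act_kernel (free_act G Y) h"
        using s S(2) s_eq by (auto simp: act_kernel_def)
    qed
    then have sub: "act_kernel (free_act G Y) \<theta> \<subseteq> act_kernel (free_act G Y) h"
      unfolding kerY[symmetric]
      by (rule generated_congruence_least[OF FY.act_congruence_kernel[OF h]])
    \<comment> \<open>With one symbol \<open>y\<close>, the words \<open>(y, m)\<close> and
      \<open>(y, \<one>)\<close> have equal images under \<open>h\<close>, namely the classes of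
      \<open>v\<close> acted on by \<open>m\<close> and of \<open>v\<close> itself.\<close>
    obtain y where "y \<in> Y"
      using Y by blast
    then have "((y, m), (y, \<one>)) \<in> act_kernel (free_act G Y) \<theta>"
      using m by (simp add: act_kernel_def free_act_def)
    then have "h (y, m) = h (y, \<one>)"
      using sub by (auto simp: act_kernel_def)
    then show ?thesis
      using m v' by (simp add: h_eq F.projection_eq_iff[OF \<sigma>] F.action_closed F.action_one)
  qed

  define \<psi> where "\<psi> w = ?\<rho> `` {\<phi> w}" for w
  have \<phi>_closed: "\<phi> w \<in> carrier A" if "w \<in> carrier F" for w
    using hom that by (rule act_homD)
  have \<psi>_hom: "\<psi> \<in> act_hom G F (rees_quotient A B)"
    unfolding act_hom_def \<psi>_def rees_quotient_def using \<phi>_closed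
    by (auto simp: A.carrier_quotient_act A.quotient_action[OF \<rho>] act_homD(2)[OF hom])
  have \<psi>_surj: "\<psi> ` carrier F = carrier (rees_quotient A B)"
    by (simp add: \<psi>_def rees_quotient_def A.carrier_quotient_act image_image flip: surj)
  have \<psi>_iff: "\<psi> w = \<psi> w' \<longleftrightarrow> \<phi> w = \<phi> w' \<or> \<phi> w \<in> B \<and> \<phi> w' \<in> B"
    if "w \<in> carrier F" "w' \<in> carrier F" for w w'
    unfolding \<psi>_def A.projection_eq_iff[OF \<rho> \<phi>_closed[OF that(1)] \<phi>_closed[OF that(2)]]
    using that \<phi>_closed by (simp add: rees_congruence_def)

  have V_B: "\<phi> v \<in> B" if "v \<in> V" for v
    using V(3) U(2) that by blast
  have "R \<subseteq> act_kernel F \<phi>"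
    unfolding ker[symmetric] by (rule generated_congruence_superset)
  then have "R \<subseteq> act_kernel F \<psi>"
    by (auto simp: act_kernel_def \<psi>_def)
  moreover have in_ker: "(w, w') \<in> act_kernel F \<psi>"
    if "w \<in> carrier F" "w' \<in> carrier F" "\<phi> w \<in> B" "\<phi> w' \<in> B" for w w'
    using that by (simp add: act_kernel_def \<psi>_iff)
  have "V \<times> V \<subseteq> act_kernel F \<psi>"
    using V(1) V_B in_ker by blast
  moreover have "(v \<cdot>\<^bsub>F\<^esub> p, v \<cdot>\<^bsub>F\<^esub> q) \<in> act_kernel F \<psi>"
    if "v \<in> V" "p \<in> carrier G" "q \<in> carrier G" for v p q
  proof -
    have "v \<in> carrier F"
      using that(1) V(1) by blast
    then show ?thesis
      using that V_B B_closed by (simp add: in_ker F.action_closed act_homD(2)[OF hom])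
  qed
  ultimately have "R' \<subseteq> act_kernel F \<psi>"
    using S_carrier by (auto simp: R'_def)
  then have "\<sigma> \<subseteq> act_kernel F \<psi>"
    unfolding \<sigma>_def by (rule generated_congruence_least[OF F.act_congruence_kernel[OF \<psi>_hom]])
  \<comment> \<open>A member of \<open>B\<close> is a generator acted on by some \<open>m\<close>,
    so \<open>w\<close> and a suitable \<open>v\<close> acted on by \<open>m\<close> represent the
    same element of \<open>A\<close>; \<open>v_collapse\<close> then removes
    \<open>m\<close>.\<close>
  moreover have to_V: "\<exists>v\<in>V. (w, v) \<in> \<sigma>" if w: "w \<in> carrier F" and "\<phi> w \<in> B" for w
  proof -
    obtain v m where v: "v \<in> V" and m: "m \<in> carrier G" and "\<phi> w = \<phi> v \<cdot>\<^bsub>A\<^esub> m"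
      using U_gen[OF \<open>\<phi> w \<in> B\<close>] V(3) by blast
    moreover have "v \<in> carrier F"
      using v V(1) by blast
    ultimately have "(w, v \<cdot>\<^bsub>F\<^esub> m) \<in> act_kernel F \<phi>"
      using w m by (simp add: act_kernel_def F.action_closed act_homD(2)[OF hom])
    then show ?thesis
      using v ker_\<sigma> v_collapse[OF v m] act_congruenceD(5)[OF \<sigma>] by blast
  qed
  have "act_kernel F \<psi> \<subseteq> \<sigma>"
  proof
    fix s assume "s \<in> act_kernel F \<psi>"
    then obtain w w' where s: "s = (w, w')" and w: "w \<in> carrier F" "w' \<in> carrier F"
      and "\<phi> w = \<phi> w' \<or> \<phi> w \<in> B \<and> \<phi> w' \<in> B"
      by (auto simp: act_kernel_def \<psi>_iff)
    then show "s \<in> \<sigma>"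
    proof (elim disjE conjE)
      assume "\<phi> w = \<phi> w'"
      then show ?thesis
        using s w ker_\<sigma> by (auto simp: act_kernel_def)
    next
      assume "\<phi> w \<in> B" "\<phi> w' \<in> B"
      then obtain v v' where "v \<in> V" "v' \<in> V" "(w, v) \<in> \<sigma>" "(w', v') \<in> \<sigma>"
        using to_V w by meson
      \<comment> \<open>The middle link of the chain from \<open>w\<close> through \<open>v\<close>
        and \<open>v'\<close> to \<open>w'\<close> is one of the relations in
        \<open>V \<times> V\<close>.\<close>
      moreover from this have "(v, v') \<in> \<sigma>"
        using R'_\<sigma> by (auto simp: R'_def)
      ultimately show ?thesis
        unfolding s by (meson act_congruenceD(4,5)[OF \<sigma>])
    qed
  qed
  ultimately have "\<sigma> = act_kernel F \<psi>"
    by blast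
  then show ?thesis
    using X finR' R' \<psi>_hom \<psi>_surj unfolding F_def \<sigma>_def by (intro finitely_presented_actI)
qed

section \<open>Finitely generated monoids\<close>

text \<open>One symbol suffices, with a relation \<open>s = \<one>\<close> for each monoid generator
  \<open>s\<close>: products of generators then collapse to \<open>\<one>\<close> as well.\<close>

lemma finitely_presented_trivial_if_finitely_generated:
  assumes "finitely_generated_monoid G"
  shows "finitely_presented_act G trivial_act"
proof -
  obtain S where S: "S \<subseteq> carrier G" "finite S"
    and gen: "\<Inter>{H. submonoid H G \<and> S \<subseteq> H} = carrier G"
    using assms by (auto simp: finitely_generated_monoid_def)
  define F where "F = free_act G {0 :: nat}"
  interpret F: monoid_act G F
    unfolding F_def by (rule monoid_act_free) simp
  define R where "R = (\<lambda>s. ((0 :: nat, s), (0 :: nat, \<one>))) ` S"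
  have R: "R \<subseteq> carrier F \<times> carrier F"
    using S(1) by (auto simp: R_def F_def free_act_def)
  define \<sigma> where "\<sigma> = generated_congruence G F R"
  have \<sigma>: "act_congruence G F \<sigma>"
    unfolding \<sigma>_def using R by (rule F.act_congruence_generated)
  \<comment> \<open>The elements congruent to \<open>\<one>\<close> form a submonoid: acting by
    \<open>n\<close> on the pair of \<open>m\<close> and \<open>\<one>\<close> makes
    \<open>m \<otimes> n\<close> congruent to \<open>n\<close>, hence to \<open>\<one>\<close>. It
    contains \<open>S\<close> and is thus all of the monoid.\<close>
  define H where "H = {m \<in> carrier G. ((0, m), (0, \<one>)) \<in> \<sigma>}"
  have "submonoid H G"
  proof
    show "\<one> \<in> H"
      using act_congruenceD(3)[OF \<sigma>] by (simp add: H_def F_def free_act_def)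
    show "m \<otimes> n \<in> H" if "m \<in> H" "n \<in> H" for m n
    proof -
      have mn: "m \<in> carrier G" "n \<in> carrier G" "((0, m), (0, \<one>)) \<in> \<sigma>" "((0, n), (0, \<one>)) \<in> \<sigma>"
        using that by (auto simp: H_def)
      have "((0, m) \<cdot>\<^bsub>F\<^esub> n, (0, \<one>) \<cdot>\<^bsub>F\<^esub> n) \<in> \<sigma>"
        using mn by (intro act_congruenceD(6)[OF \<sigma>])
      then have "((0, m \<otimes> n), (0, n)) \<in> \<sigma>"
        using mn by (simp add: F_def free_act_def)
      then show ?thesis
        using mn act_congruenceD(5)[OF \<sigma>] by (auto simp: H_def)
    qed
  qed (auto simp: H_def)
  moreover have "S \<subseteq> H"
    using S(1) generated_congruence_superset[of R G F] by (auto simp: H_def \<sigma>_def R_def)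
  ultimately have "carrier G \<subseteq> H"
    unfolding gen[symmetric] by blast
  then have "(w, (0, \<one>)) \<in> \<sigma>" if "w \<in> carrier F" for w
    using that by (auto simp: F_def free_act_def H_def)
  then show ?thesis
    using S(2) R unfolding \<sigma>_def F_def
    by (intro finitely_presented_trivial_actI[of "{0}" R]) (auto simp: R_def)
qed

end

theorem corollary4p2:
  fixes M :: "('m, 'z) monoid_scheme"
  assumes "monoid M"
  shows "(\<forall>(A :: ('a, 'm) act) B.
            monoid_act M A \<and> finitely_presented_act M A \<and>
            subact M A B \<and> finitely_generated_act M (A\<lparr>carrier := B\<rparr>) \<longrightarrow>
            (finitely_presented_act M (rees_quotient A B) \<longleftrightarrow>
             finitely_presented_act M (trivial_act :: (unit, 'm) act)))
       \<and> (finitely_generated_monoid M \<longrightarrow>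
            finitely_presented_act M (trivial_act :: (unit, 'm) act))"
proof -
  interpret monoid M by fact
  show ?thesis
    using finitely_presented_trivial_if_rees_quotient finitely_presented_rees_quotient
      finitely_presented_trivial_if_finitely_generated by blast
qed

end
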